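(* Let $a>0$, let $f\in C^2([a,\infty))$ be real-valued with $f(x)<0$ for all $x\in(a,\infty)$ and $|f|^{1/2}\notin L^1(a,\infty)$, and let $g:(a,\infty)\to\mathbb{C}$ be continuous. Assume that $\psi_{f,g}\in L^1(a,\infty)$. Then there exist two solutions $u_1$ and $u_2$ of $$u''(x)=(f(x)+g(x))\,u(x),\qquad x\in(a,\infty),$$ such that, setting $v_j(x):=|f(x)|^{1/4}u_j(x)$ for $j=1,2$, as $x\to\infty$, $$e^{-i\int_a^x|f(r)|^{1/2}\,dr}\,v_1(x)\to 1,\qquad |f(x)|^{-1/2}e^{-i\int_a^x|f(r)|^{1/2}\,dr}\,v_1'(x)\to i,$$ $$e^{i\int_a^x|f(r)|^{1/2}\,dr}\,v_2(x)\to 1,\qquad |f(x)|^{-1/2}e^{i\int_a^x|f(r)|^{1/2}\,dr}\,v_2'(x)\to -i.$$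
   Context: The function $\psi_{f,g}$ is defined by $$\psi_{f,g}(x):=|f(x)|^{-1/4}\left(-\frac{d^2}{dx^2}\bigl(|f|^{-1/4}\bigr)(x)+g(x)\,|f(x)|^{-1/4}\right).$$ A solution is a twice continuously differentiable complex-valued function on $(a,\infty)$ satisfying the equation pointwise. $L^1(I)$ denotes the absolutely integrable functions on the interval $I$. *)

theory Defs
  imports "HOL-Analysis.Analysis"
begin

text \<open>
  Derivatives are taken within S, so at an endpoint of an interval contained in S they are
  one-sided.
\<close>

definition C2_on :: "real set \<Rightarrow> (real \<Rightarrow> 'a::real_normed_vector) \<Rightarrow> bool" where
  "C2_on S h \<longleftrightarrow>
     (\<exists>h' h''. (\<forall>x\<in>S. (h has_vector_derivative h' x) (at x within S)) \<and>
              (\<forall>x\<in>S. (h' has_vector_derivative h'' x) (at x within S)) \<and>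
              continuous_on S h'')"

definition psi :: "(real \<Rightarrow> real) \<Rightarrow> (real \<Rightarrow> complex) \<Rightarrow> real \<Rightarrow> complex" where
  "psi f g x =
     complex_of_real (\<bar>f x\<bar> powr (-1/4)) *
       (- complex_of_real (deriv (deriv (\<lambda>y. \<bar>f y\<bar> powr (-1/4))) x)
        + g x * complex_of_real (\<bar>f x\<bar> powr (-1/4)))"

definition is_solution ::
    "real \<Rightarrow> (real \<Rightarrow> real) \<Rightarrow> (real \<Rightarrow> complex) \<Rightarrow> (real \<Rightarrow> complex) \<Rightarrow> bool" where
  "is_solution a f g u \<longleftrightarrow>
     C2_on {a<..} u \<and>
     (\<forall>x>a. vector_derivative (\<lambda>y. vector_derivative u (at y)) (at x)
              = (complex_of_real (f x) + g x) * u x)"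

end

theory Submission
  imports Defs
begin

text \<open>
  Put $\varphi = |f|^{-1/4}$, $p = |f|^{1/2}$ and $\theta(x) = \int_a^x p$. Writing $u = \varphi v$ turns the
  equation into the system $v' = p w$, $w' = (\psi - p) v$, and the substitution
  $v = e^{i\theta} A + e^{-i\theta} B$, $w = i (e^{i\theta} A - e^{-i\theta} B)$ (variation of constants)
  reduces it to a linear system for $(A, B)$ whose coefficients are bounded by $|\psi|$.
  As these are integrable up to infinity, $(A, B)$ can be prescribed there: the integral equation
  $Y(x) = c - \int_x^\infty F(r, Y(r))\,dr$ is solved on all of $(a,\infty)$ at once by a contraction in a
  weighted sup norm. The choices $c = (1,0)$ and $c = (0,1)$ give the two solutions.
\<close>

section \<open>Integrals over half-lines and with a variable upper limit\<close>

text \<open>The added endpoint is a null set. With it included, intervals that start at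
  \<open>a\<close> itself become subsets of the domain of integration.\<close>

lemma absolutely_integrable_atLeast_if_greaterThan:
  fixes h :: "real \<Rightarrow> 'e::euclidean_space"
  assumes "h absolutely_integrable_on {a<..}"
  shows "h absolutely_integrable_on {a..}"
proof -
  have "negligible ({a<..} - {a..} \<union> ({a..} - {a<..}))"
    by (rule negligible_subset[of "{a}"]) auto
  then show ?thesis
    using assms by (intro absolutely_integrable_spike_set[OF assms]) (auto intro: negligible_subset)
qed

lemma integrable_Icc_if_absolutely_integrable:
  fixes h :: "real \<Rightarrow> 'e::euclidean_space"
  assumes "h absolutely_integrable_on {a<..}" "a \<le> c"
  shows "h integrable_on {c..b}"
proof -
  have "{c..b} \<subseteq> {a..}" using assms(2) by auto
  then show ?thesis
    using set_integrable_subset[OF absolutely_integrable_atLeast_if_greaterThan[OF assms(1)], of "{c..b}"]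
    by (simp add: absolutely_integrable_on_def)
qed

lemma integral_tendsto_at_top:
  fixes h :: "real \<Rightarrow> 'e::euclidean_space"
  assumes "h absolutely_integrable_on {a<..}"
  shows "((\<lambda>x. integral {a..x} h) \<longlongrightarrow> integral {a..} h) at_top"
proof -
  have h: "h absolutely_integrable_on {a..}"
    using assms by (rule absolutely_integrable_atLeast_if_greaterThan)
  have "((\<lambda>x. LINT r:{a..x}|lebesgue. h r) \<longlongrightarrow> (LINT r:{a..}|lebesgue. h r)) at_top"
    by (rule tendsto_set_lebesgue_integral_at_top) (use h in auto)
  moreover have "(LINT r:{a..x}|lebesgue. h r) = integral {a..x} h" for x
    by (rule set_lebesgue_integral_eq_integral(2)) (rule set_integrable_subset[OF h], auto)
  ultimately show ?thesis
    using set_lebesgue_integral_eq_integral(2)[OF h] by simp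
qed

lemma continuous_on_integral_upto:
  fixes h :: "real \<Rightarrow> 'e::banach"
  assumes "\<And>b. h integrable_on {a..b}"
  shows "continuous_on {a..} (\<lambda>x. integral {a..x} h)"
  unfolding continuous_on_eq_continuous_within
proof
  fix x assume x: "x \<in> {a..}"
  have "continuous (at x within {a..x+1}) (\<lambda>x. integral {a..x} h)"
    using indefinite_integral_continuous_1[OF assms, of "x+1"] x
    by (auto simp: continuous_on_eq_continuous_within)
  moreover have "at x within {a..x+1} = at x within {a..}"
    by (rule at_within_nhd[of _ "{..<x+1}"]) auto
  ultimately show "continuous (at x within {a..}) (\<lambda>x. integral {a..x} h)"
    by simp
qed

lemma has_vector_derivative_integral_upto:
  fixes h :: "real \<Rightarrow> 'e::banach"
  assumes "\<And>b. h integrable_on {a..b}" "continuous_on {a<..} h" "a < x"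
  shows "((\<lambda>u. integral {a..u} h) has_vector_derivative h x) (at x)"
proof -
  have "isCont h x"
    using assms continuous_on_eq_continuous_at[of "{a<..}" h] by auto
  \<comment> \<open>The general rule permits a finite exceptional set to be removed from the
    interval; here it is empty. The endpoint \<open>x+1\<close> only serves to make \<open>x\<close>
    an interior point.\<close>
  then have "((\<lambda>u. integral {a..u} h) has_vector_derivative h x) (at x within ({a..x+1} - {}))"
    using assms by (intro integral_has_vector_derivative_continuous_at)
      (auto intro: continuous_at_imp_continuous_at_within)
  moreover have "at x within ({a..x+1}-{}) = at x"
    by (rule at_within_interior) (use assms in auto)
  ultimately show ?thesis by simp
qed

section \<open>Differential equations with a prescribed limit at infinity\<close>

text \<open>Integrability of the Lipschitz function \<open>k\<close> up to infinity is what permits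
  an initial value there. \<open>F0\<close> and \<open>lip\<close> bound \<open>F x y\<close> by
  \<open>k x * norm y\<close>, so the right-hand side is absolutely integrable along every bounded
  continuous curve. The weight gives the contraction constant \<open>1/2\<close> however large the
  integral of \<open>k\<close> is, so one fixed point covers the whole half-line.\<close>

lemma lipschitz_ode_at_infinity:
  fixes F :: "real \<Rightarrow> 'e::euclidean_space \<Rightarrow> 'e"
  assumes contF: "continuous_on ({a<..} \<times> UNIV) (\<lambda>(x, y). F x y)"
    and lip: "\<And>x y z. norm (F x y - F x z) \<le> k x * norm (y - z)"
    and F0: "\<And>x. F x 0 = 0"
    and k_nonneg: "\<And>x. 0 \<le> k x"
    and contk: "continuous_on {a<..} k"
    and intk: "k integrable_on {a<..}"
  shows "\<exists>Y. (\<forall>x>a. (Y has_vector_derivative F x (Y x)) (at x)) \<and> (Y \<longlongrightarrow> c) at_top"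
proof -
  have absk: "k absolutely_integrable_on {a<..}"
    using intk k_nonneg by (intro nonnegative_absolutely_integrable_1) auto
  have k_int: "k integrable_on {c..b}" if "a \<le> c" for b c
    by (rule integrable_Icc_if_absolutely_integrable[OF absk that])
  define K where "K x = integral {a..x} k" for x
  have K_cont: "continuous_on {a..} K"
    unfolding K_def by (intro continuous_on_integral_upto k_int) simp
  have K_deriv: "(K has_vector_derivative k x) (at x)" if "a < x" for x
    unfolding K_def using that by (intro has_vector_derivative_integral_upto k_int contk) simp_all
  have K_mono: "K x \<le> K y" if "a \<le> x" "x \<le> y" for x y
  proof (rule DERIV_nonneg_imp_increasing_open[of x y K])
    show "\<exists>d. (K has_real_derivative d) (at r) \<and> 0 \<le> d" if "x < r" "r < y" for r
      using K_deriv[of r] k_nonneg[of r] that \<open>a \<le> x\<close>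
      by (auto simp: has_real_derivative_iff_has_vector_derivative)
    show "continuous_on {x..y} K"
      by (rule continuous_on_subset[OF K_cont]) (use that in auto)
  qed (use that in auto)
  \<comment> \<open>The fixed point is sought for \<open>Y / W\<close>: since \<open>k * W\<close> is the derivative of \<open>- W / 2\<close>, the
    weight \<open>W\<close> makes the integral operator a contraction with constant \<open>1/2\<close>.\<close>
  define W where "W x = exp (- 2 * K x)" for x
  have W_cont: "continuous_on {a..} W"
    unfolding W_def by (intro continuous_intros K_cont)
  have W_pos: "0 < W x" for x by (simp add: W_def)
  have W_le1: "W x \<le> 1" if "a \<le> x" for x
    using K_mono[OF _ that] by (simp add: W_def K_def)
  have kW_int: "((\<lambda>r. k r * W r) has_integral (W x - W b) / 2) {x..b}" if "a \<le> x" "x \<le> b" for x b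
  proof -
    have "((\<lambda>r. k r * W r) has_integral (- W b / 2 - (- W x / 2))) {x..b}"
    proof (rule fundamental_theorem_of_calculus_interior)
      show "continuous_on {x..b} (\<lambda>r. - W r / 2)"
        by (intro continuous_intros continuous_on_subset[OF W_cont]) (use that in auto)
      show "((\<lambda>r. - W r / 2) has_vector_derivative k r * W r) (at r)" if "r \<in> {x<..<b}" for r
      proof -
        have "(K has_real_derivative k r) (at r)"
          using K_deriv[of r] that \<open>a \<le> x\<close> by (simp add: has_real_derivative_iff_has_vector_derivative)
        then show ?thesis
          unfolding W_def has_real_derivative_iff_has_vector_derivative[symmetric]
          by (auto intro!: derivative_eq_intros)
      qed
    qed (use that in auto)
    then show ?thesis by (simp add: diff_divide_distrib)
  qed

  \<comment> \<open>If \<open>z\<close> stands for \<open>Y / W\<close>, then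
    \<open>W r *\<^sub>R z r\<close> recovers \<open>Y\<close>, so \<open>h z\<close> is the
    right-hand side of the equation along that curve.\<close>
  define h where "h z r = F r (W r *\<^sub>R z r)" for z :: "real \<Rightarrow> 'e" and r
  \<comment> \<open>The bounded continuous functions are total, so arguments are clamped to \<open>{a..}\<close>.\<close>
  define m where "m x = max a x" for x
  have m: "a \<le> m x" for x by (simp add: m_def)
  have m_cont: "continuous_on UNIV m" unfolding m_def by (intro continuous_intros)
  have h_cont: "continuous_on {a<..} (h z)" if "continuous_on {a<..} z" for z
  proof -
    have "continuous_on {a<..} (\<lambda>r. (r, W r *\<^sub>R z r))"
      by (intro continuous_intros that continuous_on_subset[OF W_cont]) auto
    from continuous_on_compose2[OF contF this] show ?thesis
      by (auto simp: h_def)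
  qed
  have h_diff: "norm (h z r - h z' r) \<le> (k r * W r) * norm (z r - z' r)" for z z' r
    using lip[of r "W r *\<^sub>R z r" "W r *\<^sub>R z' r"] W_pos[of r]
    by (simp add: h_def flip: scaleR_diff_right)
  have h_abs: "h z absolutely_integrable_on {a<..}"
    if "continuous_on {a<..} z" and bound: "\<And>r. norm (z r) \<le> M" for z M
  proof (rule measurable_bounded_by_integrable_imp_absolutely_integrable)
    show "h z \<in> borel_measurable (lebesgue_on {a<..})"
      by (rule continuous_imp_measurable_on_sets_lebesgue[OF h_cont[OF that(1)]]) simp
    show "(\<lambda>r. M * k r) integrable_on {a<..}"
      by (rule integrable_on_mult_right[OF intk])
    show "norm (h z r) \<le> M * k r" if "r \<in> {a<..}" for r
    proof -
      have "norm (h z r) \<le> k r * W r * norm (z r)"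
        using h_diff[of z r "\<lambda>_. 0"] F0[of r] that by (simp add: h_def)
      also have "\<dots> \<le> k r * 1 * M"
        using k_nonneg[of r] W_le1[of r] W_pos[of r] bound[of r] that
        by (intro mult_mono mult_nonneg_nonneg) auto
      finally show ?thesis by (simp add: mult.commute)
    qed
  qed simp
  have bc: "continuous_on S (apply_bcontfun z)" "norm (apply_bcontfun z r) \<le> norm z"
    for z :: "real \<Rightarrow>\<^sub>C 'e" and S r
    by (auto intro: norm_bounded)
  note hz = h_abs[OF bc]
  have hz_int: "h (apply_bcontfun z) integrable_on {c..b}" if "a \<le> c" for z :: "real \<Rightarrow>\<^sub>C 'e" and c b
    by (rule integrable_Icc_if_absolutely_integrable[OF hz that])

  \<comment> \<open>The difference in \<open>T\<close> is the tail integral beyond \<open>x\<close>,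
    written through \<open>integral {a..x}\<close> so that its continuity, derivative and limit are
    those of an indefinite integral. \<open>N\<close> divides by the weight, returning from
    \<open>Y\<close> to \<open>Y / W\<close>.\<close>
  define T where "T z x = c - (integral {a..} (h z) - integral {a..x} (h z))" for z x
  define N where "N z x = (1 / W (m x)) *\<^sub>R T z (m x)" for z x
  have N_diff: "norm (N (apply_bcontfun z) x - N (apply_bcontfun z') x) \<le> 1/2 * norm (z - z')"
    for z z' :: "real \<Rightarrow>\<^sub>C 'e" and x
  proof -
    let ?y = "m x"
    let ?d = "\<lambda>b. integral {a..b} (h z) - integral {a..b} (h z')"
    \<comment> \<open>Differences are first estimated on the finite interval \<open>{?y..b}\<close>,
      where \<open>kW_int\<close> evaluates the integral of the bound. The estimate is uniform in
      \<open>b\<close>, so it survives \<open>b\<close> tending to infinity, and the division by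
      \<open>W ?y\<close> in \<open>N\<close> leaves the factor \<open>1/2\<close>.\<close>
    have "norm (?d b - ?d ?y) \<le> norm (z - z') * (W ?y / 2)" if b: "?y \<le> b" for b
    proof -
      have "?d b - ?d ?y = integral {?y..b} (h z) - integral {?y..b} (h z')"
        using Henstock_Kurzweil_Integration.integral_combine[OF m b hz_int, of z]
          Henstock_Kurzweil_Integration.integral_combine[OF m b hz_int, of z']
        by (simp add: algebra_simps)
      also have "\<dots> = integral {?y..b} (\<lambda>r. h z r - h z' r)"
        by (simp add: Henstock_Kurzweil_Integration.integral_diff hz_int m)
      finally have "norm (?d b - ?d ?y) = norm (integral {?y..b} (\<lambda>r. h z r - h z' r))"
        by simp
      also have "\<dots> \<le> integral {?y..b} (\<lambda>r. norm (z - z') * (k r * W r))"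
      proof (rule Henstock_Kurzweil_Integration.integral_norm_bound_integral)
        show "(\<lambda>r. h z r - h z' r) integrable_on {?y..b}"
          by (intro Henstock_Kurzweil_Integration.integrable_diff hz_int m)
        show "(\<lambda>r. norm (z - z') * (k r * W r)) integrable_on {?y..b}"
          using kW_int[OF m b] by (intro integrable_on_mult_right) blast
        show "norm (h z r - h z' r) \<le> norm (z - z') * (k r * W r)" for r
        proof -
          have "k r * W r * norm (z r - z' r) \<le> k r * W r * norm (z - z')"
            using bc(2)[of "z - z'" r] k_nonneg[of r] W_pos[of r] by (intro mult_left_mono) auto
          then show ?thesis using h_diff[of z r z'] by (simp add: mult.commute)
        qed
      qed
      also have "\<dots> = norm (z - z') * ((W ?y - W b) / 2)"
        using has_integral_mult_right[OF kW_int[OF m b]] by blast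
      also have "\<dots> \<le> norm (z - z') * (W ?y / 2)"
        using W_pos[of b] by (intro mult_left_mono) auto
      finally show ?thesis .
    qed
    then have ev: "\<forall>\<^sub>F b in at_top. norm (?d b - ?d ?y) \<le> norm (z - z') * (W ?y / 2)"
      by (auto simp: eventually_at_top_linorder)
    have "((\<lambda>b. norm (?d b - ?d ?y)) \<longlongrightarrow> norm (integral {a..} (h z) - integral {a..} (h z') - ?d ?y)) at_top"
      by (intro tendsto_intros integral_tendsto_at_top hz)
    from tendsto_upperbound[OF this ev]
    have "norm (integral {a..} (h z) - integral {a..} (h z') - ?d ?y) \<le> norm (z - z') * (W ?y / 2)"
      by simp
    moreover have "norm (T z ?y - T z' ?y) = norm (integral {a..} (h z) - integral {a..} (h z') - ?d ?y)"
      unfolding T_def by (subst norm_minus_commute) (simp add: algebra_simps)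
    moreover have "norm (N z x - N z' x) = norm (T z ?y - T z' ?y) / W ?y"
      using W_pos[of ?y] by (simp add: N_def flip: scaleR_diff_right)
    ultimately show ?thesis
      using W_pos[of ?y] by (simp add: pos_divide_le_eq)
  qed
  have T_cont: "continuous_on {a..} (T z)" for z :: "real \<Rightarrow>\<^sub>C 'e"
    unfolding T_def by (intro continuous_intros continuous_on_integral_upto hz_int) simp
  have N_cont: "continuous_on UNIV (N z)" for z :: "real \<Rightarrow>\<^sub>C 'e"
  proof -
    have "continuous_on {a..} (\<lambda>x. (1 / W x) *\<^sub>R T z x)"
      using W_pos by (intro continuous_intros T_cont W_cont) (auto simp: less_le)
    from continuous_on_compose2[OF this m_cont] show ?thesis
      using m by (auto simp: N_def)
  qed
  have T_lim: "(T z \<longlongrightarrow> c) at_top" for z :: "real \<Rightarrow>\<^sub>C 'e"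
  proof -
    have "(T z \<longlongrightarrow> c - (integral {a..} (h z) - integral {a..} (h z))) at_top"
      unfolding T_def by (intro tendsto_intros integral_tendsto_at_top hz)
    then show ?thesis by simp
  qed
  \<comment> \<open>At \<open>z = 0\<close> the integrand vanishes and \<open>N\<close> reduces to
    \<open>c\<close> divided by the weight. The weight stays away from 0 because \<open>K\<close> is
    bounded by the total integral of \<open>k\<close>. Together with \<open>N_diff\<close> this
    bounds \<open>N z\<close> for every bounded \<open>z\<close>.\<close>
  have N0_bound: "norm (N (apply_bcontfun 0) x) \<le> norm c * exp (2 * integral {a..} k)" for x
  proof -
    have "h (apply_bcontfun 0) = (\<lambda>_. 0)"
      using F0 by (simp add: h_def fun_eq_iff)
    then have "T (apply_bcontfun 0) (m x) = c"
      by (simp only: T_def integral_0 diff_self diff_zero)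
    moreover have "K (m x) \<le> integral {a..} k"
    proof (rule tendsto_lowerbound)
      show "((\<lambda>b. integral {a..b} k) \<longlongrightarrow> integral {a..} k) at_top"
        by (rule integral_tendsto_at_top[OF absk])
      show "\<forall>\<^sub>F b in at_top. K (m x) \<le> integral {a..b} k"
        using K_mono[OF m] by (auto simp: K_def eventually_at_top_linorder)
    qed simp
    moreover have "1 / W (m x) = exp (2 * K (m x))"
      by (simp add: W_def exp_minus inverse_eq_divide)
    ultimately show ?thesis
      by (simp add: N_def mult.commute[of _ "norm c"] mult_left_mono)
  qed
  have N_bc: "N (apply_bcontfun z) \<in> bcontfun" for z :: "real \<Rightarrow>\<^sub>C 'e"
  proof (rule bcontfun_normI[OF N_cont])
    show "norm (N z x) \<le> 1/2 * norm z + norm c * exp (2 * integral {a..} k)" for x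
      using N_diff[of z x 0] N0_bound[of x]
        norm_triangle_sub[of "N z x" "N (apply_bcontfun 0) x"] by simp
  qed
  have "\<exists>!z. Bcontfun (N (apply_bcontfun z)) = z"
  proof (rule banach_fix_type[of "1/2"])
    show "\<forall>z z'. dist (Bcontfun (N (apply_bcontfun z))) (Bcontfun (N (apply_bcontfun z')))
        \<le> 1/2 * dist z z'"
    proof (intro allI dist_bound)
      fix z z' :: "real \<Rightarrow>\<^sub>C 'e" and x
      show "dist (Bcontfun (N z) x) (Bcontfun (N z') x) \<le> 1/2 * dist z z'"
        using N_diff[of z x z'] by (simp add: Bcontfun_inverse[OF N_bc] dist_norm)
    qed
  qed simp_all
  then obtain z where "Bcontfun (N (apply_bcontfun z)) = z" by blast
  then have fixp: "N z x = z x" for x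
    using Bcontfun_inverse[OF N_bc, of z] by metis
  \<comment> \<open>On \<open>{a..}\<close> the clamping \<open>m\<close> is the identity, so the
    fixed point equation can be freed of the weight. It makes \<open>h z x\<close> equal to
    \<open>F x (T z x)\<close>, and hence \<open>T z\<close> is the desired solution.\<close>
  have T_eq: "T z x = W x *\<^sub>R z x" if "a \<le> x" for x
  proof -
    have "z x = (1 / W x) *\<^sub>R T z x"
      using fixp[of x] that by (simp add: N_def m_def max_absorb2)
    then show ?thesis using W_pos[of x] by simp
  qed
  have "(T z has_vector_derivative F x (T z x)) (at x)" if "a < x" for x
  proof -
    have "((\<lambda>x. integral {a..x} (h z)) has_vector_derivative h z x) (at x)"
      using that by (intro has_vector_derivative_integral_upto hz_int h_cont bc) simp_all
    then have "(T z has_vector_derivative h z x) (at x)"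
      unfolding T_def by (auto intro!: derivative_eq_intros)
    then show ?thesis using T_eq[of x] that by (simp add: h_def)
  qed
  with T_lim show ?thesis by blast
qed

section \<open>The oscillator with an integrable perturbation\<close>

lemma has_vector_derivative_exp_of_real:
  assumes "(\<theta> has_vector_derivative p) (at x)"
  shows "((\<lambda>x. exp (c * complex_of_real (\<theta> x))) has_vector_derivative
    c * of_real p * exp (c * complex_of_real (\<theta> x))) (at x)"
proof -
  have "((\<lambda>x. complex_of_real (\<theta> x)) has_vector_derivative of_real p) (at x)"
    using assms by (intro has_vector_derivative_of_real)
      (simp add: has_real_derivative_iff_has_vector_derivative)
  moreover have "((\<lambda>z. exp (c * z)) has_field_derivative
      c * exp (c * complex_of_real (\<theta> x))) (at (of_real (\<theta> x)))"
    by (auto intro!: derivative_eq_intros)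
  ultimately show ?thesis
    using field_vector_diff_chain_at by (fastforce simp: o_def mult_ac)
qed

text \<open>A factor of modulus 1 does not change the norm of \<open>d x - d' x\<close>. This turns
  closeness to an oscillating exponential into an honest limit once the opposite phase is multiplied
  in.\<close>

lemma tendsto_mult_unimodular:
  fixes e d d' :: "'b \<Rightarrow> complex"
  assumes "((\<lambda>x. d x - d' x) \<longlongrightarrow> 0) F" "\<And>x. norm (e x) = 1" "\<And>x. e x * d' x = l"
  shows "((\<lambda>x. e x * d x) \<longlongrightarrow> l) F"
proof -
  have "((\<lambda>x. e x * (d x - d' x)) \<longlongrightarrow> 0) F"
    using tendsto_norm_zero[OF assms(1)] assms(2)
    by (subst tendsto_norm_zero_iff[symmetric]) (simp add: norm_mult)
  then show ?thesis
    using assms(3) by (subst Lim_null) (simp add: right_diff_distrib)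
qed

text \<open>For \<open>q = 0\<close> the system is a rotation through the phase \<theta>, solved by
  the two exponentials with constant coefficients. Letting the coefficients vary absorbs
  \<open>p\<close> into the unimodular exponentials and leaves a linear system controlled by the
  integrable function \<open>2 * norm (q x)\<close>, to which
  \<open>lipschitz_ode_at_infinity\<close> applies.\<close>

lemma perturbed_oscillator:
  fixes \<theta> p :: "real \<Rightarrow> real" and q :: "real \<Rightarrow> complex"
  assumes \<theta>: "\<And>x. a < x \<Longrightarrow> (\<theta> has_vector_derivative p x) (at x)"
    and contq: "continuous_on {a<..} q"
    and intq: "q absolutely_integrable_on {a<..}"
  shows "\<exists>v w.
    (\<forall>x>a. (v has_vector_derivative of_real (p x) * w x) (at x)) \<and>
    (\<forall>x>a. (w has_vector_derivative (q x - of_real (p x)) * v x) (at x)) \<and>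
    ((\<lambda>x. v x - (c1 * exp (\<i> * of_real (\<theta> x)) + c2 * exp (- \<i> * of_real (\<theta> x)))) \<longlongrightarrow> 0) at_top \<and>
    ((\<lambda>x. w x - \<i> * (c1 * exp (\<i> * of_real (\<theta> x)) - c2 * exp (- \<i> * of_real (\<theta> x)))) \<longlongrightarrow> 0) at_top"
proof -
  define E where "E x = exp (\<i> * complex_of_real (\<theta> x))" for x
  define E' where "E' x = exp (- \<i> * complex_of_real (\<theta> x))" for x
  have EE': "E x * E' x = 1" for x
    unfolding E_def E'_def by (simp flip: exp_add)
  have normE: "norm (E x) = 1" "norm (E' x) = 1" for x
    by (auto simp: E_def E'_def norm_exp_eq_Re)
  have E_deriv: "(E has_vector_derivative \<i> * of_real (p x) * E x) (at x)"
    "(E' has_vector_derivative - \<i> * of_real (p x) * E' x) (at x)" if "a < x" for x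
    unfolding E_def[abs_def] E'_def[abs_def]
    using has_vector_derivative_exp_of_real[OF \<theta>[OF that]] by blast+
  have E_cont: "continuous_on {a<..} E" "continuous_on {a<..} E'"
    using E_deriv by (auto intro!: continuous_at_imp_continuous_on
        intro: has_vector_derivative_continuous)
  \<comment> \<open>\<open>V\<close> expresses \<open>v\<close> through the pair of coefficients
    \<open>(A, B)\<close>. \<open>F\<close> solves the conditions \<open>E A' + E' B' = 0\<close>
    and \<open>i (E A' - E' B') = q v\<close> for the derivatives of \<open>A\<close> and
    \<open>B\<close>; since \<open>E E' = 1\<close>, dividing by one exponential is multiplying by
    the other.\<close>
  define V where "V x Y = E x * fst Y + E' x * snd Y" for x and Y :: "complex \<times> complex"
  define F where "F x Y = (q x * V x Y / (2 * \<i>) * E' x, - (q x * V x Y / (2 * \<i>)) * E x)" for x Y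
  \<comment> \<open>Linearity in the second argument reduces the Lipschitz condition to the norm
    bound \<open>F_norm\<close>.\<close>
  have F_diff: "F x Y - F x Z = F x (Y - Z)" for x Y Z
    by (simp add: F_def V_def prod_eq_iff field_simps)
  have F_norm: "norm (F x Y) \<le> 2 * norm (q x) * norm Y" for x Y
  proof -
    have "norm (V x Y) \<le> norm (fst Y) + norm (snd Y)"
      unfolding V_def by (rule norm_triangle_le) (simp add: norm_mult normE)
    also have "\<dots> \<le> 2 * norm Y"
      using norm_fst_le[of "fst Y" "snd Y"] norm_snd_le[of "snd Y" "fst Y"] by simp
    finally have V: "norm (V x Y) \<le> 2 * norm Y" .
    have "norm (F x Y) \<le> norm (q x) * norm (V x Y)"
      unfolding F_def using norm_Pair_le[of "q x * V x Y / (2 * \<i>) * E' x" "- (q x * V x Y / (2 * \<i>)) * E x"]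
      by (simp add: norm_mult norm_divide normE)
    also have "\<dots> \<le> norm (q x) * (2 * norm Y)"
      by (intro mult_left_mono V) simp
    finally show ?thesis by (simp add: mult_ac)
  qed
  have "\<exists>Y. (\<forall>x>a. (Y has_vector_derivative F x (Y x)) (at x)) \<and> (Y \<longlongrightarrow> (c1, c2)) at_top"
  proof (rule lipschitz_ode_at_infinity)
    have *: "continuous_on ({a<..} \<times> (UNIV :: (complex \<times> complex) set)) (\<lambda>z. G (fst z))"
      if "continuous_on {a<..} G" for G :: "real \<Rightarrow> complex"
      by (rule continuous_on_compose2[OF that]) (auto intro: continuous_intros)
    show "continuous_on ({a<..} \<times> UNIV) (\<lambda>(x, Y). F x Y)"
      unfolding F_def V_def case_prod_beta
      by (intro continuous_intros * contq E_cont) auto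
    show "norm (F x Y - F x Z) \<le> 2 * norm (q x) * norm (Y - Z)" for x Y Z
      unfolding F_diff by (rule F_norm)
    show "continuous_on {a<..} (\<lambda>x. 2 * norm (q x))"
      by (intro continuous_intros contq)
    show "(\<lambda>x. 2 * norm (q x)) integrable_on {a<..}"
      using intq by (intro integrable_on_mult_right) (simp add: absolutely_integrable_on_def)
  qed (auto simp: F_def V_def zero_prod_def)
  then obtain Y where Y: "\<And>x. a < x \<Longrightarrow> (Y has_vector_derivative F x (Y x)) (at x)"
    and Y_lim: "(Y \<longlongrightarrow> (c1, c2)) at_top" by blast
  define A where "A x = fst (Y x)" for x
  define B where "B x = snd (Y x)" for x
  define v where "v x = E x * A x + E' x * B x" for x
  define w where "w x = \<i> * (E x * A x - E' x * B x)" for x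
  have V: "V x (Y x) = v x" for x by (simp add: V_def v_def A_def B_def)
  have A_deriv: "(A has_vector_derivative q x * v x / (2 * \<i>) * E' x) (at x)"
    and B_deriv: "(B has_vector_derivative - (q x * v x / (2 * \<i>)) * E x) (at x)" if "a < x" for x
    using bounded_linear.has_vector_derivative[OF bounded_linear_fst Y[OF that]]
      bounded_linear.has_vector_derivative[OF bounded_linear_snd Y[OF that]]
    by (simp_all add: F_def V A_def[abs_def] B_def[abs_def])
  have v_deriv: "(v has_vector_derivative of_real (p x) * w x) (at x)" if "a < x" for x
  proof -
    have "(v has_vector_derivative
        E x * (q x * v x / (2 * \<i>) * E' x) + \<i> * of_real (p x) * E x * A x +
        (E' x * (- (q x * v x / (2 * \<i>)) * E x) + - \<i> * of_real (p x) * E' x * B x)) (at x)"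
      unfolding v_def[abs_def]
      using A_deriv[OF that] B_deriv[OF that] E_deriv[OF that] unfolding v_def
      by (intro has_vector_derivative_add has_vector_derivative_mult)
    then show ?thesis
      by (rule back_subst[where P = "\<lambda>d. (v has_vector_derivative d) (at x)"])
        (simp add: w_def algebra_simps)
  qed
  have w_deriv: "(w has_vector_derivative (q x - of_real (p x)) * v x) (at x)" if "a < x" for x
  proof -
    have "(w has_vector_derivative \<i> * (
        E x * (q x * v x / (2 * \<i>) * E' x) + \<i> * of_real (p x) * E x * A x -
        (E' x * (- (q x * v x / (2 * \<i>)) * E x) + - \<i> * of_real (p x) * E' x * B x))) (at x)"
      unfolding w_def[abs_def]
      using A_deriv[OF that] B_deriv[OF that] E_deriv[OF that]
      by (intro has_vector_derivative_mult_right has_vector_derivative_diff has_vector_derivative_mult)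
    \<comment> \<open>The product \<open>E x * E' x\<close> is kept intact here, so that
      \<open>EE'\<close> can replace it by 1 and leave exactly \<open>q x * v x\<close>.\<close>
    moreover have "\<i> * (
        E x * (q x * v x / (2 * \<i>) * E' x) + \<i> * of_real (p x) * E x * A x -
        (E' x * (- (q x * v x / (2 * \<i>)) * E x) + - \<i> * of_real (p x) * E' x * B x))
      = q x * v x * (E x * E' x) - of_real (p x) * (E x * A x + E' x * B x)"
      by (simp add: field_simps)
    ultimately show ?thesis
      by (simp add: EE' left_diff_distrib flip: v_def)
  qed
  have A0: "((\<lambda>x. A x - c1) \<longlongrightarrow> 0) at_top" and B0: "((\<lambda>x. B x - c2) \<longlongrightarrow> 0) at_top"
    using tendsto_fst[OF Y_lim] tendsto_snd[OF Y_lim] by (auto simp: A_def B_def LIM_zero)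
  have EA: "((\<lambda>x. E x * (A x - c1)) \<longlongrightarrow> 0) at_top" and EB: "((\<lambda>x. E' x * (B x - c2)) \<longlongrightarrow> 0) at_top"
    using tendsto_mult_unimodular[where d' = "\<lambda>_. 0" and l = 0 and e = E, OF _ normE(1)] A0
      tendsto_mult_unimodular[where d' = "\<lambda>_. 0" and l = 0 and e = E', OF _ normE(2)] B0
    by simp_all
  have "((\<lambda>x. v x - (c1 * E x + c2 * E' x)) \<longlongrightarrow> 0) at_top"
    using tendsto_add[OF EA EB] by (simp add: v_def algebra_simps)
  moreover have "((\<lambda>x. w x - \<i> * (c1 * E x - c2 * E' x)) \<longlongrightarrow> 0) at_top"
    using tendsto_mult[OF tendsto_const[of \<i>] tendsto_diff[OF EA EB]]
    by (simp add: w_def algebra_simps)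
  ultimately show ?thesis
    unfolding E_def E'_def using v_deriv w_deriv by blast
qed

section \<open>The Liouville-Green transformation\<close>

text \<open>For \<open>x > a\<close> the absolute value is \<open>- f x\<close>, a positive
  \<open>C2\<close> base, so the power can be differentiated twice explicitly. At \<open>a\<close>
  itself \<open>f\<close> may vanish, hence the open half-line. The last conclusion links the
  explicit second derivative to the iterated \<open>deriv\<close> in \<open>psi\<close>.\<close>

lemma C2_powr_minus_quarter:
  fixes f :: "real \<Rightarrow> real"
  assumes "C2_on {a..} f" and neg: "\<And>x. x > a \<Longrightarrow> f x < 0"
  obtains \<phi>' \<phi>'' where
    "\<And>x. a < x \<Longrightarrow> ((\<lambda>y. \<bar>f y\<bar> powr (-1/4)) has_real_derivative \<phi>' x) (at x)"
    "\<And>x. a < x \<Longrightarrow> (\<phi>' has_real_derivative \<phi>'' x) (at x)"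
    "continuous_on {a<..} \<phi>''"
    "\<And>x. a < x \<Longrightarrow> deriv (deriv (\<lambda>y. \<bar>f y\<bar> powr (-1/4))) x = \<phi>'' x"
proof -
  obtain f' f'' where f: "\<forall>x\<in>{a..}. (f has_vector_derivative f' x) (at x within {a..})"
    "\<forall>x\<in>{a..}. (f' has_vector_derivative f'' x) (at x within {a..})"
    and f''_cont: "continuous_on {a..} f''"
    using assms(1) unfolding C2_on_def by blast
  have at_eq: "at x within {a..} = at x" if "a < x" for x
    by (rule at_within_interior) (use that in auto)
  have f_deriv: "(f has_real_derivative f' x) (at x)" "(f' has_real_derivative f'' x) (at x)"
    if "a < x" for x
    using bspec[OF f(1), of x] bspec[OF f(2), of x] at_eq[OF that] that
    by (simp_all add: has_real_derivative_iff_has_vector_derivative)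
  have f_cont: "continuous_on {a<..} f" "continuous_on {a<..} f'" "continuous_on {a<..} f''"
    using f_deriv[THEN DERIV_isCont]
    by (simp_all add: continuous_at_imp_continuous_on continuous_on_subset[OF f''_cont] subset_iff)
  have powr_deriv: "((\<lambda>y. (- f y) powr c) has_real_derivative c * (- f x) powr (c - 1) * (- f' x)) (at x)"
    if "a < x" for x c
    using f_deriv(1)[OF that] neg[OF that]
    by (auto intro!: derivative_eq_intros simp: powr_diff)
  let ?\<phi> = "\<lambda>x. \<bar>f x\<bar> powr (-1/4)"
  let ?\<phi>' = "\<lambda>x. 1/4 * (- f x) powr (-5/4) * f' x"
  let ?\<phi>'' = "\<lambda>x. 5/16 * (- f x) powr (-9/4) * (f' x)\<^sup>2 + 1/4 * (- f x) powr (-5/4) * f'' x"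
  have 1: "(?\<phi> has_real_derivative ?\<phi>' x) (at x)" if "a < x" for x
  proof (rule has_field_derivative_transform_within_open[where S = "{a<..}"])
    show "((\<lambda>y. (- f y) powr (-1/4)) has_real_derivative ?\<phi>' x) (at x)"
      using powr_deriv[OF that, of "-1/4"] by simp
  qed (use that neg in \<open>auto simp: abs_of_neg\<close>)
  have 2: "(?\<phi>' has_real_derivative ?\<phi>'' x) (at x)" if "a < x" for x
  proof -
    have "(?\<phi>' has_real_derivative
        1/4 * (-5/4 * (- f x) powr (-5/4 - 1) * (- f' x)) * f' x + f'' x * (1/4 * (- f x) powr (-5/4))) (at x)"
      by (intro DERIV_mult DERIV_cmult powr_deriv f_deriv that)
    then show ?thesis
      by (rule back_subst[where P = "\<lambda>d. (?\<phi>' has_real_derivative d) (at x)"])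
        (simp add: power2_eq_square mult_ac)
  qed
  have 3: "continuous_on {a<..} ?\<phi>''"
    by (intro continuous_intros f_cont) (use neg in force)+
  have 4: "deriv (deriv ?\<phi>) x = ?\<phi>'' x" if "a < x" for x
  proof (rule DERIV_imp_deriv)
    show "(deriv ?\<phi> has_real_derivative ?\<phi>'' x) (at x)"
      \<comment> \<open>The outer derivative depends on the inner one near \<open>x\<close>, so the
        two expressions for the inner derivative have to agree on an open set.\<close>
      by (rule has_field_derivative_transform_within_open[where S = "{a<..}", OF 2])
        (use that DERIV_imp_deriv[OF 1] in auto)
  qed
  show thesis
    by (rule that[OF 1 2 3 4])
qed

text \<open>With \<phi> the power \<open>-1/4\<close> of the absolute value of \<open>f\<close>,
  differentiating \<open>u = \<phi> v\<close> gives \<open>u' = \<phi>' v + w / \<phi>\<close>. In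
  the second derivative the two terms with \<open>\<phi>' w\<close> cancel, \<open>\<phi>''\<close>
  cancels against its negative in \<open>psi f g x / \<phi>\<close>, and the remaining
  \<open>- v / \<phi>^3\<close> is \<open>f u\<close>.\<close>

lemma liouville_green_solution:
  fixes a :: real and f :: "real \<Rightarrow> real" and g :: "real \<Rightarrow> complex"
  assumes C2: "C2_on {a..} f" and neg: "\<And>x. x > a \<Longrightarrow> f x < 0"
    and contg: "continuous_on {a<..} g"
    and v: "\<And>x. a < x \<Longrightarrow> (v has_vector_derivative of_real (\<bar>f x\<bar> powr (1/2)) * w x) (at x)"
    and w: "\<And>x. a < x \<Longrightarrow> (w has_vector_derivative (psi f g x - of_real (\<bar>f x\<bar> powr (1/2))) * v x) (at x)"
  shows "is_solution a f g (\<lambda>x. of_real (\<bar>f x\<bar> powr (-1/4)) * v x)"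
proof -
  define \<phi> where "\<phi> x = \<bar>f x\<bar> powr (-1/4)" for x
  obtain \<phi>' \<phi>'' where \<phi>_deriv: "\<And>x. a < x \<Longrightarrow> (\<phi> has_real_derivative \<phi>' x) (at x)"
    "\<And>x. a < x \<Longrightarrow> (\<phi>' has_real_derivative \<phi>'' x) (at x)"
    and \<phi>'': "\<And>x. a < x \<Longrightarrow> deriv (deriv (\<lambda>y. \<bar>f y\<bar> powr (-1/4))) x = \<phi>'' x"
    using C2_powr_minus_quarter[OF C2 neg] unfolding \<phi>_def[abs_def] by metis
  have \<phi>_pos: "0 < \<phi> x" if "a < x" for x
    using neg[OF that] by (simp add: \<phi>_def)
  \<comment> \<open>Writing all powers of \<open>f\<close> through \<phi> makes the final identities
    rational in \<phi>, without real exponents.\<close>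
  have p_eq: "\<bar>f x\<bar> powr (1/2) = 1 / (\<phi> x)\<^sup>2" if "a < x" for x
  proof -
    have "(\<phi> x)\<^sup>2 = \<bar>f x\<bar> powr (-1/2)"
      by (simp add: \<phi>_def power2_eq_square flip: powr_add)
    then show ?thesis by (simp add: powr_minus_divide)
  qed
  have f_eq: "f x = - 1 / (\<phi> x) ^ 4" if "a < x" for x
  proof -
    have "(\<phi> x) ^ 4 = \<bar>f x\<bar> powr (-1)"
      by (simp add: \<phi>_def eval_nat_numeral flip: powr_add)
    then show ?thesis using neg[OF that] by (simp add: powr_minus_divide)
  qed
  have psi_eq: "psi f g x = of_real (\<phi> x) * (- of_real (\<phi>'' x) + g x * of_real (\<phi> x))" if "a < x" for x
    by (simp only: psi_def \<phi>''[OF that] \<phi>_def)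
  define u where "u x = of_real (\<phi> x) * v x" for x
  define u' where "u' x = of_real (\<phi>' x) * v x + of_real (1 / \<phi> x) * w x" for x
  have u_deriv: "(u has_vector_derivative u' x) (at x)" if "a < x" for x
  proof -
    have "(u has_vector_derivative of_real (\<phi> x) * (of_real (1 / (\<phi> x)\<^sup>2) * w x) + of_real (\<phi>' x) * v x) (at x)"
      unfolding u_def[abs_def] using v[OF that] p_eq[OF that] \<phi>_deriv(1)[OF that]
      by (intro has_vector_derivative_mult has_vector_derivative_of_real) simp_all
    then show ?thesis
      by (rule back_subst[where P = "\<lambda>d. (u has_vector_derivative d) (at x)"])
        (use \<phi>_pos[OF that] in \<open>simp add: u'_def power2_eq_square\<close>)
  qed
  have u'_deriv: "(u' has_vector_derivative (of_real (f x) + g x) * u x) (at x)" if "a < x" for x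
  proof -
    have inv_deriv: "((\<lambda>x. 1 / \<phi> x) has_real_derivative - \<phi>' x / (\<phi> x)\<^sup>2) (at x)"
      using \<phi>_deriv(1)[OF that] \<phi>_pos[OF that]
      by (auto intro!: derivative_eq_intros simp: power2_eq_square)
    have "(u' has_vector_derivative
        (of_real (\<phi>' x) * (of_real (1 / (\<phi> x)\<^sup>2) * w x) + of_real (\<phi>'' x) * v x) +
        (of_real (1 / \<phi> x) * ((psi f g x - of_real (1 / (\<phi> x)\<^sup>2)) * v x)
          + of_real (- \<phi>' x / (\<phi> x)\<^sup>2) * w x)) (at x)"
      unfolding u'_def[abs_def] using v[OF that] w[OF that] p_eq[OF that] \<phi>_deriv(2)[OF that] inv_deriv
      by (intro has_vector_derivative_add has_vector_derivative_mult has_vector_derivative_of_real) simp_all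
    then show ?thesis
      by (rule back_subst[where P = "\<lambda>d. (u' has_vector_derivative d) (at x)"])
        (use \<phi>_pos[OF that] in \<open>simp add: u_def psi_eq[OF that] f_eq[OF that] field_simps eval_nat_numeral\<close>)
  qed
  have "continuous_on {a<..} u"
    using u_deriv by (auto intro!: continuous_at_imp_continuous_on intro: has_vector_derivative_continuous)
  moreover have "continuous_on {a<..} f"
    using C2 unfolding C2_on_def
    by (auto simp: continuous_on_eq_continuous_within
        intro!: continuous_within_subset[of _ "{a..}" f "{a<..}"] intro: has_vector_derivative_continuous)
  ultimately have "continuous_on {a<..} (\<lambda>x. (of_real (f x) + g x) * u x)"
    by (intro continuous_intros contg)
  then have "C2_on {a<..} u"
    unfolding C2_on_def using u_deriv u'_deriv
    by (intro exI[of _ u'] exI[of _ "\<lambda>x. (of_real (f x) + g x) * u x"])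
      (simp add: has_vector_derivative_at_within)
  moreover have "vector_derivative (\<lambda>y. vector_derivative u (at y)) (at x) = (of_real (f x) + g x) * u x"
    if "a < x" for x
  proof (rule vector_derivative_at)
    show "((\<lambda>y. vector_derivative u (at y)) has_vector_derivative (of_real (f x) + g x) * u x) (at x)"
      by (rule has_vector_derivative_transform_within_open[where S = "{a<..}", OF u'_deriv])
        (use that u_deriv in \<open>auto intro: vector_derivative_at[symmetric]\<close>)
  qed
  ultimately show ?thesis
    unfolding is_solution_def u_def[abs_def] \<phi>_def by blast
qed

lemma continuous_on_psi:
  assumes C2: "C2_on {a..} f" and neg: "\<And>x. x > a \<Longrightarrow> f x < 0" and contg: "continuous_on {a<..} g"
  shows "continuous_on {a<..} (psi f g)"
proof -
  obtain \<phi>' \<phi>'' where \<phi>: "\<And>x. a < x \<Longrightarrow> ((\<lambda>y. \<bar>f y\<bar> powr (-1/4)) has_real_derivative \<phi>' x) (at x)"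
    "\<And>x. a < x \<Longrightarrow> deriv (deriv (\<lambda>y. \<bar>f y\<bar> powr (-1/4))) x = \<phi>'' x"
    and \<phi>''_cont: "continuous_on {a<..} \<phi>''"
    using C2_powr_minus_quarter[OF C2 neg] by metis
  have \<phi>_cont: "continuous_on {a<..} (\<lambda>y. \<bar>f y\<bar> powr (-1/4))"
    using \<phi>(1) by (force intro!: continuous_at_imp_continuous_on intro: DERIV_isCont)
  have "continuous_on {a<..} (\<lambda>x. complex_of_real (\<bar>f x\<bar> powr (-1/4)) *
      (- complex_of_real (\<phi>'' x) + g x * complex_of_real (\<bar>f x\<bar> powr (-1/4))))"
    by (intro continuous_intros \<phi>_cont \<phi>''_cont contg)
  then show ?thesis
    by (rule continuous_on_eq) (simp only: psi_def \<phi>(2) greaterThan_iff)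
qed

section \<open>The two oscillating solutions and their asymptotics\<close>

theorem proposition3p2:
  fixes a :: real and f :: "real \<Rightarrow> real" and g :: "real \<Rightarrow> complex"
  assumes "a > 0"
    and "C2_on {a..} f"
    and "\<And>x. x > a \<Longrightarrow> f x < 0"
    and "\<not> (\<lambda>x. \<bar>f x\<bar> powr (1/2)) absolutely_integrable_on {a<..}"
    and "continuous_on {a<..} g"
    and "psi f g absolutely_integrable_on {a<..}"
  shows "\<exists>u1 u2 :: real \<Rightarrow> complex.
    is_solution a f g u1 \<and> is_solution a f g u2 \<and>
    (let \<theta> = (\<lambda>x. complex_of_real (integral {a..x} (\<lambda>r. \<bar>f r\<bar> powr (1/2))));
         v1 = (\<lambda>x. complex_of_real (\<bar>f x\<bar> powr (1/4)) * u1 x);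
         v2 = (\<lambda>x. complex_of_real (\<bar>f x\<bar> powr (1/4)) * u2 x)
     in ((\<lambda>x. exp (- \<i> * \<theta> x) * v1 x) \<longlongrightarrow> 1) at_top \<and>
        ((\<lambda>x. complex_of_real (\<bar>f x\<bar> powr (-1/2)) * exp (- \<i> * \<theta> x)
               * vector_derivative v1 (at x)) \<longlongrightarrow> \<i>) at_top \<and>
        ((\<lambda>x. exp (\<i> * \<theta> x) * v2 x) \<longlongrightarrow> 1) at_top \<and>
        ((\<lambda>x. complex_of_real (\<bar>f x\<bar> powr (-1/2)) * exp (\<i> * \<theta> x)
               * vector_derivative v2 (at x)) \<longlongrightarrow> - \<i>) at_top)"
proof -
  note C2 = assms(2) and neg = assms(3)
  define p where "p = (\<lambda>r. \<bar>f r\<bar> powr (1/2))"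
  define \<theta> where "\<theta> x = integral {a..x} p" for x
  define E where "E x = exp (\<i> * complex_of_real (\<theta> x))" for x
  define E' where "E' x = exp (- \<i> * complex_of_real (\<theta> x))" for x
  have EE': "E x * E' x = 1" "E' x * E x = 1" "norm (E x) = 1" "norm (E' x) = 1" for x
    unfolding E_def E'_def by (simp_all add: norm_exp_eq_Re flip: exp_add)
  have "continuous_on {a..} f"
    using C2 unfolding C2_on_def
    by (auto simp: continuous_on_eq_continuous_within intro: has_vector_derivative_continuous)
  \<comment> \<open>Continuity is needed at \<open>a\<close> too, as the phase integral starts
    there. Since \<open>f a\<close> may be 0, the power is rewritten as a square root, which is
    continuous also at 0.\<close>
  then have p_cont: "continuous_on {a..} p"
    unfolding p_def by (simp add: powr_half_sqrt) (intro continuous_intros)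
  have p_int: "p integrable_on {a..b}" for b
    by (intro integrable_continuous_real continuous_on_subset[OF p_cont]) auto
  have \<theta>: "(\<theta> has_vector_derivative p x) (at x)" if "a < x" for x
    unfolding \<theta>_def[abs_def]
    using that by (intro has_vector_derivative_integral_upto p_int continuous_on_subset[OF p_cont]) auto
  have p_inv: "\<bar>f x\<bar> powr (-1/2) * p x = 1" if "a < x" for x
    using neg[OF that] by (simp add: p_def flip: powr_add)
  have quarter_inv: "\<bar>f x\<bar> powr (1/4) * \<bar>f x\<bar> powr (-1/4) = 1" if "a < x" for x
    using neg[OF that] by (simp flip: powr_add)
  \<comment> \<open>Both solutions are instances of one statement with free coefficients at
    infinity. Its second limit is that of \<open>w\<close>, recovered from \<open>v' = p w\<close>
    by multiplying with the power \<open>-1/2\<close>.\<close>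
  have solution: "\<exists>u. is_solution a f g u \<and>
      ((\<lambda>x. of_real (\<bar>f x\<bar> powr (1/4)) * u x - (c1 * E x + c2 * E' x)) \<longlongrightarrow> 0) at_top \<and>
      ((\<lambda>x. of_real (\<bar>f x\<bar> powr (-1/2)) * vector_derivative (\<lambda>x. of_real (\<bar>f x\<bar> powr (1/4)) * u x) (at x)
        - \<i> * (c1 * E x - c2 * E' x)) \<longlongrightarrow> 0) at_top" for c1 c2
  proof -
    obtain v w where v: "\<And>x. a < x \<Longrightarrow> (v has_vector_derivative of_real (p x) * w x) (at x)"
      and w: "\<And>x. a < x \<Longrightarrow> (w has_vector_derivative (psi f g x - of_real (p x)) * v x) (at x)"
      and v_lim: "((\<lambda>x. v x - (c1 * E x + c2 * E' x)) \<longlongrightarrow> 0) at_top"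
      and w_lim: "((\<lambda>x. w x - \<i> * (c1 * E x - c2 * E' x)) \<longlongrightarrow> 0) at_top"
      using perturbed_oscillator[OF \<theta> continuous_on_psi[OF C2 neg assms(5)] assms(6), of c1 c2]
      unfolding E_def E'_def by blast
    define u where "u = (\<lambda>x. of_real (\<bar>f x\<bar> powr (-1/4)) * v x)"
    have sol: "is_solution a f g u"
      unfolding u_def using v w unfolding p_def
      by (intro liouville_green_solution[OF C2 neg assms(5)])
    have v_eq: "v x = of_real (\<bar>f x\<bar> powr (1/4)) * u x" if "a < x" for x
      using arg_cong[OF quarter_inv[OF that], of complex_of_real] by (simp add: u_def flip: mult.assoc)
    have "w x = of_real (\<bar>f x\<bar> powr (-1/2)) * vector_derivative (\<lambda>x. of_real (\<bar>f x\<bar> powr (1/4)) * u x) (at x)"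
      if "a < x" for x
    proof -
      have "((\<lambda>x. of_real (\<bar>f x\<bar> powr (1/4)) * u x) has_vector_derivative of_real (p x) * w x) (at x)"
        by (rule has_vector_derivative_transform_within_open[where S = "{a<..}", OF v])
          (use that v_eq in auto)
      then show ?thesis
        using arg_cong[OF p_inv[OF that], of complex_of_real]
        by (simp add: vector_derivative_at flip: mult.assoc)
    qed
    \<comment> \<open>The identities for \<open>v\<close> and \<open>w\<close> are established only
      beyond \<open>a\<close>, which suffices for limits at infinity.\<close>
    then have "\<forall>\<^sub>F x in at_top. w x - \<i> * (c1 * E x - c2 * E' x) = of_real (\<bar>f x\<bar> powr (-1/2))
        * vector_derivative (\<lambda>x. of_real (\<bar>f x\<bar> powr (1/4)) * u x) (at x) - \<i> * (c1 * E x - c2 * E' x)"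
      by (intro eventually_mono[OF eventually_gt_at_top[of a]]) simp
    moreover have "\<forall>\<^sub>F x in at_top. v x - (c1 * E x + c2 * E' x)
        = of_real (\<bar>f x\<bar> powr (1/4)) * u x - (c1 * E x + c2 * E' x)"
      using v_eq by (intro eventually_mono[OF eventually_gt_at_top[of a]]) simp
    ultimately show ?thesis
      by (intro exI[of _ u] conjI sol Lim_transform_eventually[OF v_lim] Lim_transform_eventually[OF w_lim])
  qed
  obtain u1 where u1: "is_solution a f g u1"
    "((\<lambda>x. of_real (\<bar>f x\<bar> powr (1/4)) * u1 x - E x) \<longlongrightarrow> 0) at_top"
    "((\<lambda>x. of_real (\<bar>f x\<bar> powr (-1/2)) * vector_derivative (\<lambda>x. of_real (\<bar>f x\<bar> powr (1/4)) * u1 x) (at x)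
        - \<i> * E x) \<longlongrightarrow> 0) at_top"
    using solution[of 1 0] by auto
  obtain u2 where u2: "is_solution a f g u2"
    "((\<lambda>x. of_real (\<bar>f x\<bar> powr (1/4)) * u2 x - E' x) \<longlongrightarrow> 0) at_top"
    "((\<lambda>x. of_real (\<bar>f x\<bar> powr (-1/2)) * vector_derivative (\<lambda>x. of_real (\<bar>f x\<bar> powr (1/4)) * u2 x) (at x)
        - (- \<i> * E' x)) \<longlongrightarrow> 0) at_top"
    using solution[of 0 1] by auto
  have E'_mult: "E' x * (\<i> * E x) = \<i>" and E_mult: "E x * (- \<i> * E' x) = - \<i>" for x
    using EE'(1,2)[of x] by (simp_all add: mult.left_commute)
  \<comment> \<open>Each solution is multiplied by the exponential of opposite phase:
    \<open>E'\<close> for \<open>u1\<close> and \<open>E\<close> for \<open>u2\<close>.\<close>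
  note lims =
    tendsto_mult_unimodular[OF u1(2) EE'(4,2)]
    tendsto_mult_unimodular[OF u1(3) EE'(4) E'_mult]
    tendsto_mult_unimodular[OF u2(2) EE'(3,1)]
    tendsto_mult_unimodular[OF u2(3) EE'(3) E_mult]
  show ?thesis
    unfolding Let_def
    using u1(1) u2(1) lims unfolding E_def E'_def \<theta>_def p_def
    by (intro exI[of _ u1] exI[of _ u2] conjI) (simp_all only: mult.assoc mult.left_commute)
qed
end
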